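(* Let $\lambda$ be a nonzero real number. Define the degenerate B-algorithm matrix $(a_{n,m}(\lambda))_{n,m\ge0}$ by $a_{0,m}(\lambda)=(1/2)^m$ for $m\ge0$ and \[ a_{n,m}(\lambda)=\big(m-(n-1)\lambda\big)a_{n-1,m}(\lambda)-(m+1)a_{n-1,m+1}(\lambda),\qquad n\ge1,\ m\ge0. \] Then for every $n\ge0$, \[ a_{n,0}(\lambda)=\sum_{k=0}^{n}(-1)^{k}k!\,{n \brace k}_{\lambda}\Big(\frac12\Big)^{k}=\mathcal{E}_{n,\lambda}, \qquad \sum_{k=0}^{n}S_{1,\lambda}(n,k)\,\mathcal{E}_{k,\lambda}=(-1)^{n}\frac{n!}{2^{n}}. \]
   Context: For $n\ge0$ set $(x)_{0,\lambda}=1$, $(x)_{n,\lambda}=x(x-\lambda)\cdots(x-(n-1)\lambda)$ for $n\ge1$, and $(x)_0=1$, $(x)_n=x(x-1)\cdots(x-n+1)$ for $n\ge1$. The degenerate exponential is $e_\lambda(t)=\sum_{k\ge0}(1)_{k,\lambda}\frac{t^k}{k!}$ (i.e. $(1+\lambda t)^{1/\lambda}$), and $\log_\lambda$ is its compositional inverse, so $\log_\lambda(1+t)=\sum_{n\ge1}\frac{(-1)^{n-1}}{n}\binom{n-1-\lambda}{n-1}t^n$. The degenerate Stirling numbers of the second kind ${n \brace k}_{\lambda}$ are defined by $(x)_{n,\lambda}=\sum_{k=0}^{n}{n \brace k}_{\lambda}(x)_{k}$; the degenerate Stirling numbers of the first kind $S_{1,\lambda}(n,k)$ are defined by $\frac{1}{k!}(\log_\lambda(1+t))^k=\sum_{n\ge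 k}S_{1,\lambda}(n,k)\frac{t^n}{n!}$. The degenerate Euler numbers are defined by $\frac{2}{e_\lambda(t)+1}=\sum_{n\ge0}\mathcal{E}_{n,\lambda}\frac{t^n}{n!}$. *)

theory Defs
  imports "HOL-Computational_Algebra.Formal_Power_Series"
begin

text \<open>
  Throughout, \<open>lam\<close> is the parameter \<open>\<lambda>\<close> of the degenerate notions.  The value \<open>dff lam x n\<close> is
  \<open>(x)\<^sub>n\<^sub>,\<^sub>\<lambda>\<close>, and \<open>dff 1 x n\<close> is the ordinary falling factorial \<open>(x)\<^sub>n\<close>.
\<close>

definition dff :: "real \<Rightarrow> real \<Rightarrow> nat \<Rightarrow> real" where
  "dff lam x n = (\<Prod>i<n. x - real i * lam)"

definition deg_exp :: "real \<Rightarrow> real fps" where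
  "deg_exp lam = Abs_fps (\<lambda>k. dff lam 1 k / fact k)"

text \<open>
  The power series \<open>log\<^sub>\<lambda>(1 + t)\<close> in \<open>t\<close>.  That \<open>log\<^sub>\<lambda>\<close> is the compositional inverse of \<open>e\<^sub>\<lambda>\<close>
  means that this series is the compositional inverse of \<open>e\<^sub>\<lambda>(t) - 1\<close>, which has zero
  constant term.
\<close>

definition deg_log1p :: "real \<Rightarrow> real fps" where
  "deg_log1p lam = fps_inv (deg_exp lam - 1)"

text \<open>
  \<open>deg_stirling2 lam n\<close> is the coefficient sequence of \<open>(x)\<^sub>n\<^sub>,\<^sub>\<lambda>\<close> in the basis \<open>(x)\<^sub>k\<close>, extended by
  zero beyond \<open>n\<close>; existence and uniqueness are shown in \<open>deg_stirling2_ex1\<close> below.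
\<close>

definition deg_stirling2 :: "real \<Rightarrow> nat \<Rightarrow> nat \<Rightarrow> real" where
  "deg_stirling2 lam n = (THE c. (\<forall>k>n. c k = 0) \<and>
      (\<forall>x::real. dff lam x n = (\<Sum>k\<le>n. c k * dff 1 x k)))"

definition deg_stirling1 :: "real \<Rightarrow> nat \<Rightarrow> nat \<Rightarrow> real" where
  "deg_stirling1 lam n k = fact n * fps_nth (fps_const (1 / fact k) * deg_log1p lam ^ k) n"

definition deg_euler :: "real \<Rightarrow> nat \<Rightarrow> real" where
  "deg_euler lam n = fact n * fps_nth (2 / (deg_exp lam + 1)) n"

fun deg_B_matrix :: "real \<Rightarrow> nat \<Rightarrow> nat \<Rightarrow> real" where
  "deg_B_matrix lam 0 m = (1 / 2) ^ m"
| "deg_B_matrix lam (Suc n) m =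
     (real m - real n * lam) * deg_B_matrix lam n m - real (m + 1) * deg_B_matrix lam n (m + 1)"

lemma dff_0 [simp]: "dff lam x 0 = 1"
  by (simp add: dff_def)

lemma dff_Suc: "dff lam x (Suc n) = dff lam x n * (x - real n * lam)"
  by (simp add: dff_def)

lemma deg_log1p_inverse:
  "deg_log1p lam oo (deg_exp lam - 1) = fps_X"
  "(deg_exp lam - 1) oo deg_log1p lam = fps_X"
  unfolding deg_log1p_def
  by (rule fps_inv fps_inv_right; simp add: deg_exp_def dff_def)+

lemma deg_stirling2_exists:
  "\<exists>c. (\<forall>k>n. c k = 0) \<and> (\<forall>x::real. dff lam x n = (\<Sum>k\<le>n. c k * dff 1 x k))"
proof (induction n)
  case 0
  show ?case by (rule exI[of _ "\<lambda>k. if k = 0 then 1 else 0"]) simp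
next
  case (Suc n)
  then obtain c where c0: "\<And>k. k > n \<Longrightarrow> c k = 0"
    and c: "\<And>x. dff lam x n = (\<Sum>k\<le>n. c k * dff 1 x k)" by blast
  define d where "d k = (if k = 0 then 0 else c (k - 1)) + c k * (real k - real n * lam)" for k
  have "dff lam x (Suc n) = (\<Sum>k\<le>Suc n. d k * dff 1 x k)" for x
  proof -
    have "dff lam x (Suc n) = (\<Sum>k\<le>n. c k * dff 1 x k * (x - real n * lam))"
      by (simp add: dff_Suc c sum_distrib_right)
    also have "\<dots> = (\<Sum>k\<le>n. c k * dff 1 x (Suc k) + c k * (real k - real n * lam) * dff 1 x k)"
      by (intro sum.cong refl) (simp add: dff_Suc algebra_simps)
    also have "\<dots> = (\<Sum>k\<le>n. c k * dff 1 x (Suc k)) + (\<Sum>k\<le>Suc n. c k * (real k - real n * lam) * dff 1 x k)"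
      by (simp add: sum.distrib c0)
    also have "(\<Sum>k\<le>n. c k * dff 1 x (Suc k)) =
        (\<Sum>k\<le>Suc n. (if k = 0 then 0 else c (k - 1)) * dff 1 x k)"
      by (simp only: sum.atMost_Suc_shift) simp
    finally show ?thesis by (simp only: d_def distrib_right sum.distrib)
  qed
  moreover have "\<forall>k>Suc n. d k = 0" by (simp add: d_def c0)
  ultimately show ?case by blast
qed

lemma dff_1_nat_eq_0: "j < k \<Longrightarrow> dff 1 (real j) k = 0"
  by (auto simp: dff_def)

lemma dff_1_nat_neq_0: "dff 1 (real j) j \<noteq> 0"
  by (simp add: dff_def)

lemma dff_1_coeffs_unique:
  assumes "\<And>x::real. (\<Sum>k\<le>n. c k * dff 1 x k) = (\<Sum>k\<le>n. d k * dff 1 x k)" and "j \<le> n"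
  shows "c j = d j"
  using \<open>j \<le> n\<close>
proof (induction j rule: less_induct)
  case (less j)
  have trunc: "(\<Sum>k\<le>n. b k * dff 1 (real j) k) = (\<Sum>k<j. b k * dff 1 (real j) k) + b j * dff 1 (real j) j"
    for b :: "nat \<Rightarrow> real"
  proof -
    have "(\<Sum>k\<le>n. b k * dff 1 (real j) k) = (\<Sum>k\<le>j. b k * dff 1 (real j) k)"
      using less.prems by (intro sum.mono_neutral_right) (auto simp: dff_1_nat_eq_0)
    then show ?thesis by (simp add: lessThan_Suc_atMost[symmetric])
  qed
  have "(\<Sum>k<j. c k * dff 1 (real j) k) = (\<Sum>k<j. d k * dff 1 (real j) k)"
    using less by (intro sum.cong) auto
  with assms(1)[of "real j"] show ?case
    by (simp add: trunc dff_1_nat_neq_0)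
qed

lemma deg_stirling2_ex1:
  "\<exists>!c. (\<forall>k>n. c k = 0) \<and> (\<forall>x::real. dff lam x n = (\<Sum>k\<le>n. c k * dff 1 x k))"
proof -
  have "c = d"
    if "(\<forall>k>n. c k = 0) \<and> (\<forall>x. dff lam x n = (\<Sum>k\<le>n. c k * dff 1 x k))"
      "(\<forall>k>n. d k = 0) \<and> (\<forall>x. dff lam x n = (\<Sum>k\<le>n. d k * dff 1 x k))" for c d
  proof
    fix k
    show "c k = d k"
    proof (cases "k \<le> n")
      case True
      have "(\<Sum>k\<le>n. c k * dff 1 x k) = (\<Sum>k\<le>n. d k * dff 1 x k)" for x
        using that by simp
      then show ?thesis using True by (rule dff_1_coeffs_unique)
    next
      case False
      then show ?thesis using that by simp
    qed
  qed
  with deg_stirling2_exists[of n lam] show ?thesis by (intro ex_ex1I) blast+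
qed

lemma dff_eq_sum_deg_stirling2:
  "dff lam x n = (\<Sum>k\<le>n. deg_stirling2 lam n k * dff 1 x k)"
  unfolding deg_stirling2_def using theI'[OF deg_stirling2_ex1[of n lam]] by blast

end

theory Submission
  imports Defs
begin

text \<open>
  Since \<open>(1 + \<lambda>t) u' = 1 + u\<close> for \<open>u = e\<^sub>\<lambda>(t) - 1\<close>, the coefficients of \<open>u\<^sup>k/k!\<close> obey the recurrence
  of the degenerate Stirling numbers of the second kind.  Hence expanding \<open>2/(e\<^sub>\<lambda>(t) + 1) = 2/(2 + u)\<close>
  in powers of \<open>u\<close> gives the sum for the Euler numbers, and substituting \<open>log\<^sub>\<lambda>(1 + t)\<close> for \<open>t\<close>
  turns it into \<open>2/(2 + t)\<close>, which is the last identity.  The \<open>n\<close>-th row of the matrix has the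
  generating function \<open>A\<^sub>n\<close> with \<open>A\<^sub>n\<^sub>+\<^sub>1 = ((t - 1)D - n\<lambda>) A\<^sub>n\<close>; as \<open>(t - 1)D\<close> acts on
  \<open>(t - 1)\<^sup>k D\<^sup>k A\<^sub>0\<close> in the way multiplication by \<open>x\<close> acts on \<open>(x)\<^sub>k\<close>, \<open>A\<^sub>n\<close> is the combination
  of these series with Stirling coefficients, to be evaluated at \<open>t = 0\<close>.
\<close>

text \<open>Stand-in for \<open>deg_stirling2\<close> that gives access to power series; the two are
  identified in \<open>deg_stirling2_eq_egf_coeff\<close>.\<close>

definition stirling2_egf_coeff :: "real \<Rightarrow> nat \<Rightarrow> nat \<Rightarrow> real" where
  "stirling2_egf_coeff lam n k = fact n * fps_nth ((deg_exp lam - 1) ^ k) n / fact k"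

lemma deg_exp_nth_0 [simp]: "fps_nth (deg_exp lam) 0 = 1"
  by (simp add: deg_exp_def)

text \<open>After clearing factorials, the coefficient of t^n is \<open>dff_Suc\<close> at x =
  1.\<close>

lemma deg_exp_ode: "(1 + fps_const lam * fps_X) * fps_deriv (deg_exp lam) = deg_exp lam"
proof (rule fps_ext)
  fix n
  have c: "fps_nth (fps_deriv (deg_exp lam)) n = dff lam 1 (Suc n) / fact n" for n
    by (simp add: deg_exp_def field_simps del: of_nat_Suc)
  show "fps_nth ((1 + fps_const lam * fps_X) * fps_deriv (deg_exp lam)) n = fps_nth (deg_exp lam) n"
    unfolding distrib_right mult.assoc fps_add_nth fps_mult_left_const_nth mult_1_left
      fps_X_mult_nth c
    by (cases n) (simp_all add: deg_exp_def dff_Suc divide_simps, simp_all add: algebra_simps)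
qed

lemma stirling2_egf_coeff_eq_0: "n < k \<Longrightarrow> stirling2_egf_coeff lam n k = 0"
  by (simp add: stirling2_egf_coeff_def startsby_zero_power_prefix)

lemma stirling2_egf_coeff_0: "stirling2_egf_coeff lam 0 k = (if k = 0 then 1 else 0)"
  by (simp add: stirling2_egf_coeff_def fps_nth_power_0)

lemma stirling2_egf_coeff_Suc:
  "stirling2_egf_coeff lam (Suc n) k =
     (if k = 0 then 0 else stirling2_egf_coeff lam n (k - 1))
       + (real k - real n * lam) * stirling2_egf_coeff lam n k"
proof (cases k)
  case 0
  then show ?thesis by (simp add: stirling2_egf_coeff_def)
next
  case (Suc j)
  define u where "u = deg_exp lam - 1"
  have "(1 + fps_const lam * fps_X) * fps_deriv u = 1 + u"
    using deg_exp_ode[of lam] by (simp add: u_def)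
  moreover have "(1 + fps_const lam * fps_X) * fps_deriv (u ^ Suc j)
      = fps_const (real (Suc j)) * ((1 + fps_const lam * fps_X) * fps_deriv u * u ^ j)"
    by (simp only: fps_deriv_power diff_Suc_1 mult_ac)
  ultimately have "(1 + fps_const lam * fps_X) * fps_deriv (u ^ Suc j)
      = fps_const (real (Suc j)) * (u ^ j + u ^ Suc j)"
    by (simp add: distrib_right del: of_nat_Suc)
  then have "fps_nth (fps_deriv (u ^ Suc j)) n + lam * fps_nth (fps_X * fps_deriv (u ^ Suc j)) n
      = real (Suc j) * (fps_nth (u ^ j) n + fps_nth (u ^ Suc j) n)"
    by (metis (no_types, lifting) distrib_right fps_add_nth fps_mult_left_const_nth mult.assoc mult_1_left)
  then have "real (Suc n) * fps_nth (u ^ Suc j) (Suc n) + lam * (real n * fps_nth (u ^ Suc j) n)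
      = real (Suc j) * (fps_nth (u ^ j) n + fps_nth (u ^ Suc j) n)"
    by (cases n) (simp_all del: of_nat_Suc power_Suc)
  then have "real (Suc n) * fps_nth (u ^ Suc j) (Suc n)
      = real (Suc j) * fps_nth (u ^ j) n + (real (Suc j) - real n * lam) * fps_nth (u ^ Suc j) n"
    by (simp add: algebra_simps del: of_nat_Suc power_Suc)
  \<comment> \<open>Since k! = (j + 1) j!, this factor absorbs \<open>real (Suc j)\<close> and
    leaves n!/j!, the normalisation for \<open>k - 1\<close>.\<close>
  then have "fact n / fact k * (real (Suc n) * fps_nth (u ^ Suc j) (Suc n))
      = fact n / fact k * (real (Suc j) * fps_nth (u ^ j) n
          + (real (Suc j) - real n * lam) * fps_nth (u ^ Suc j) n)"
    by simp
  then show ?thesis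
    unfolding stirling2_egf_coeff_def u_def[symmetric] Suc
    by (simp add: field_simps del: of_nat_Suc power_Suc)
qed

text \<open>An index shift moves the recurrence from the coefficients to the weights
  \<open>g\<close>. It serves twice: for falling factorials and for the series that build the matrix
  rows.\<close>

lemma sum_stirling2_egf_coeff_Suc:
  "(\<Sum>k\<le>Suc n. stirling2_egf_coeff lam (Suc n) k * g k) =
     (\<Sum>k\<le>n. stirling2_egf_coeff lam n k * (g (Suc k) + (real k - real n * lam) * g k))"
proof -
  have "(\<Sum>k\<le>Suc n. stirling2_egf_coeff lam (Suc n) k * g k)
      = (\<Sum>k\<le>Suc n. (if k = 0 then 0 else stirling2_egf_coeff lam n (k - 1)) * g k)
        + (\<Sum>k\<le>Suc n. (real k - real n * lam) * stirling2_egf_coeff lam n k * g k)"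
    by (simp only: stirling2_egf_coeff_Suc distrib_right sum.distrib)
  also have "(\<Sum>k\<le>Suc n. (if k = 0 then 0 else stirling2_egf_coeff lam n (k - 1)) * g k)
      = (\<Sum>k\<le>n. stirling2_egf_coeff lam n k * g (Suc k))"
    by (simp only: sum.atMost_Suc_shift) simp
  also have "(\<Sum>k\<le>Suc n. (real k - real n * lam) * stirling2_egf_coeff lam n k * g k)
      = (\<Sum>k\<le>n. (real k - real n * lam) * stirling2_egf_coeff lam n k * g k)"
    by (simp add: stirling2_egf_coeff_eq_0)
  finally show ?thesis
    by (simp add: sum.distrib[symmetric] algebra_simps)
qed

lemma dff_eq_sum_stirling2_egf_coeff:
  "dff lam x n = (\<Sum>k\<le>n. stirling2_egf_coeff lam n k * dff 1 x k)"
proof (induction n)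
  case 0
  show ?case by (simp add: stirling2_egf_coeff_0)
next
  case (Suc n)
  have "dff lam x (Suc n) = (\<Sum>k\<le>n. stirling2_egf_coeff lam n k * dff 1 x k) * (x - real n * lam)"
    by (simp add: dff_Suc Suc)
  \<comment> \<open>Uses x (x)_k = (x)_{k+1} + k (x)_k.\<close>
  also have "\<dots> = (\<Sum>k\<le>n. stirling2_egf_coeff lam n k
      * (dff 1 x (Suc k) + (real k - real n * lam) * dff 1 x k))"
    unfolding sum_distrib_right by (intro sum.cong refl) (simp add: dff_Suc algebra_simps)
  finally show ?case by (simp only: sum_stirling2_egf_coeff_Suc)
qed

lemma deg_stirling2_eq_egf_coeff: "deg_stirling2 lam n k = stirling2_egf_coeff lam n k"
proof -
  have "deg_stirling2 lam n = stirling2_egf_coeff lam n"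
    unfolding deg_stirling2_def
    using stirling2_egf_coeff_eq_0 dff_eq_sum_stirling2_egf_coeff
    by (intro the1_equality[OF deg_stirling2_ex1]) blast
  then show ?thesis by simp
qed

text \<open>The right-hand side is the row recursion of \<open>deg_B_matrix\<close> without its
  \<open>lam\<close> term.\<close>

lemma fps_X_minus_1_deriv_nth:
  fixes f :: "real fps"
  shows "fps_nth ((fps_X - 1) * fps_deriv f) m
    = real m * fps_nth f m - real (m + 1) * fps_nth f (m + 1)"
  by (cases m) (simp_all add: left_diff_distrib del: of_nat_Suc)

text \<open>Product rule; the factor \<open>fps_X - 1\<close> restores the power lost in
  differentiating \<open>(fps_X - 1) ^ k\<close>.\<close>

lemma euler_operator_power_deriv:
  fixes f :: "real fps"
  shows "(fps_X - 1) * fps_deriv ((fps_X - 1) ^ k * fps_nth_deriv k f)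
    = fps_const (real k) * ((fps_X - 1) ^ k * fps_nth_deriv k f)
      + (fps_X - 1) ^ Suc k * fps_nth_deriv (Suc k) f"
proof (cases k)
  case (Suc j)
  define h where "h = fps_nth_deriv k f"
  have "fps_deriv ((fps_X - 1) ^ k * h)
      = (fps_X - 1) ^ k * fps_deriv h + fps_const (real k) * (fps_X - 1) ^ j * h"
    by (simp add: fps_deriv_power Suc del: of_nat_Suc power_Suc)
  then have "(fps_X - 1) * fps_deriv ((fps_X - 1) ^ k * h)
      = fps_const (real k) * ((fps_X - 1) ^ k * h) + (fps_X - 1) ^ Suc k * fps_deriv h"
    by (simp only: Suc power_Suc distrib_left mult_ac add_ac)
  then show ?thesis
    by (simp only: h_def fps_nth_deriv_commute)
qed simp

lemma deg_B_matrix_eq_sum: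
  "deg_B_matrix lam n m = (\<Sum>k\<le>n. stirling2_egf_coeff lam n k
     * fps_nth ((fps_X - 1) ^ k * fps_nth_deriv k (Abs_fps (\<lambda>m. (1 / 2) ^ m))) m)"
\<comment> \<open>Each step of the recursion draws on columns m and m + 1 of the previous
  row.\<close>
proof (induction n arbitrary: m)
  case 0
  show ?case by (simp add: stirling2_egf_coeff_0)
next
  case (Suc n)
  define g :: "nat \<Rightarrow> real fps"
    where "g k = (fps_X - 1) ^ k * fps_nth_deriv k (Abs_fps (\<lambda>m. (1 / 2) ^ m))" for k
  have g: "real m * fps_nth (g k) m - real (m + 1) * fps_nth (g k) (m + 1)
      = real k * fps_nth (g k) m + fps_nth (g (Suc k)) m" for k
    unfolding fps_X_minus_1_deriv_nth[symmetric] g_def euler_operator_power_deriv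
    by simp
  have IH: "deg_B_matrix lam n m = (\<Sum>k\<le>n. stirling2_egf_coeff lam n k * fps_nth (g k) m)" for m
    using Suc by (simp add: g_def)
  have "deg_B_matrix lam (Suc n) m = (\<Sum>k\<le>n. stirling2_egf_coeff lam n k
      * (real m * fps_nth (g k) m - real (m + 1) * fps_nth (g k) (m + 1) - real n * lam * fps_nth (g k) m))"
    by (simp add: IH sum_distrib_left sum_subtractf[symmetric] algebra_simps)
  also have "\<dots> = (\<Sum>k\<le>n. stirling2_egf_coeff lam n k
      * (fps_nth (g (Suc k)) m + (real k - real n * lam) * fps_nth (g k) m))"
    unfolding g by (simp add: algebra_simps)
  also have "\<dots> = (\<Sum>k\<le>Suc n. stirling2_egf_coeff lam (Suc n) k * fps_nth (g k) m)"
    by (simp only: sum_stirling2_egf_coeff_Suc)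
  finally show ?case by (simp only: g_def)
qed

text \<open>Geometric series with ratio -t/2.\<close>

lemma two_over_two_plus_X: "2 / (fps_X + 2) = Abs_fps (\<lambda>n. (- 1 / 2) ^ n :: real)"
proof -
  have "Abs_fps (\<lambda>n. (- 1 / 2) ^ n :: real) * (fps_X + 2) = 2"
  proof (rule fps_ext)
    fix n
    show "fps_nth (Abs_fps (\<lambda>n. (- 1 / 2) ^ n) * (fps_X + 2)) n = fps_nth (2 :: real fps) n"
      by (cases n) (simp_all add: distrib_left fps_numeral_fps_const)
  qed
  moreover have "fps_X + 2 \<noteq> (0 :: real fps)"
    by (rule fps_nonzeroI[of _ 0]) simp
  ultimately show ?thesis
    by (metis nonzero_mult_div_cancel_right)
qed

lemma deg_euler_egf:
  "2 / (deg_exp lam + 1) = Abs_fps (\<lambda>n. (- 1 / 2) ^ n) oo (deg_exp lam - 1)"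
proof -
  \<comment> \<open>The constant term is 2. Nonvanishing lets the composition distribute over the
    quotient.\<close>
  have "1 + deg_exp lam \<noteq> 0"
    by (rule fps_nonzeroI[of _ 0]) simp
  have "2 / (deg_exp lam + 1) = (2 oo (deg_exp lam - 1)) / ((fps_X + 2) oo (deg_exp lam - 1))"
    by (simp add: fps_compose_add_distrib add.commute)
  also have "\<dots> = (2 / (fps_X + 2)) oo (deg_exp lam - 1)"
    using \<open>1 + deg_exp lam \<noteq> 0\<close>
    by (intro fps_compose_divide_distrib[symmetric]) (simp_all add: fps_compose_add_distrib add.commute)
  finally show ?thesis by (simp add: two_over_two_plus_X)
qed

theorem theorem2p6:
  fixes lam :: real and n :: nat
  assumes "lam \<noteq> 0"
  shows "deg_B_matrix lam n 0 =
           (\<Sum>k=0..n. (-1) ^ k * fact k * deg_stirling2 lam n k * (1 / 2) ^ k)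
       \<and> (\<Sum>k=0..n. (-1) ^ k * fact k * deg_stirling2 lam n k * (1 / 2) ^ k) = deg_euler lam n
       \<and> (\<Sum>k=0..n. deg_stirling1 lam n k * deg_euler lam k) = (-1) ^ n * (fact n / 2 ^ n)"
proof (intro conjI)
  show "deg_B_matrix lam n 0 =
      (\<Sum>k=0..n. (-1) ^ k * fact k * deg_stirling2 lam n k * (1 / 2) ^ k)"
    unfolding deg_B_matrix_eq_sum atLeast0AtMost deg_stirling2_eq_egf_coeff
    \<comment> \<open>At t = 0 the power contributes (-1)^k, and the k-th derivative of the
      geometric series contributes k!/2^k.\<close>
    by (intro sum.cong refl) (simp add: fps_nth_power_0 fps_deriv_maclauren_0)
  show "(\<Sum>k=0..n. (-1) ^ k * fact k * deg_stirling2 lam n k * (1 / 2) ^ k) = deg_euler lam n"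
    unfolding deg_euler_def deg_euler_egf fps_compose_nth sum_distrib_left
      deg_stirling2_eq_egf_coeff stirling2_egf_coeff_def
    by (intro sum.cong refl) (simp add: power_minus[of "1 / 2"] power_one_over)
  \<comment> \<open>By associativity of composition, \<open>deg_log1p lam\<close> cancels
    \<open>deg_exp lam - 1\<close>.\<close>
  have "(2 / (deg_exp lam + 1)) oo deg_log1p lam
      = Abs_fps (\<lambda>n. (- 1 / 2) ^ n) oo ((deg_exp lam - 1) oo deg_log1p lam)"
    unfolding deg_euler_egf
    by (rule fps_compose_assoc[symmetric]) (simp_all add: deg_log1p_def fps_inv_def)
  also have "\<dots> = Abs_fps (\<lambda>n. (- 1 / 2) ^ n)"
    by (simp add: deg_log1p_inverse)
  finally have "fps_nth ((2 / (deg_exp lam + 1)) oo deg_log1p lam) n = (- 1 / 2) ^ n"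
    by simp
  then have "fact n * (\<Sum>k=0..n. fps_nth (2 / (deg_exp lam + 1)) k * fps_nth (deg_log1p lam ^ k) n)
      = fact n * (- 1 / 2) ^ n"
    by (simp only: fps_compose_nth)
  \<comment> \<open>The k! in \<open>deg_euler\<close> cancels the 1/k! in
    \<open>deg_stirling1\<close>.\<close>
  then show "(\<Sum>k=0..n. deg_stirling1 lam n k * deg_euler lam k) = (-1) ^ n * (fact n / 2 ^ n)"
    by (simp add: deg_stirling1_def deg_euler_def sum_distrib_left mult_ac
        power_minus[of "1 / 2"] power_one_over)
qed

end
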